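(* Let $K$ be a field of characteristic different from $2$, let $m\ge1$, let $a_1,\dots,a_m\in K$, and put $a_0=0$, $a_{-s}=-a_s$ for $1\le s\le m$, and $a_s=0$ for $|s|>m$. Let $P_n=\operatorname{perm}(a_{j-i})_{i,j=1}^n$. Then $P_{2k+1}=0$ for all $k\ge0$, and the even-size subsequence $(P_{2k})_{k\ge0}$ has a homogeneous constant-coefficient annihilator of degree at most $$\frac12\binom{2m}m.$$
   Context: $\operatorname{perm}$ denotes the permanent and $P_0=1$. A homogeneous constant-coefficient annihilator of degree $d$ of $(u_k)_{k\ge0}$ is a monic polynomial $t^d+c_1t^{d-1}+\dots+c_d$ with $u_{k+d}+c_1u_{k+d-1}+\dots+c_du_k=0$ for all $k\ge0$. *)

theory Defs
  imports
    "Jordan_Normal_Form.Matrix"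
    "HOL-Combinatorics.Permutations"
    "HOL-Computational_Algebra.Polynomial"
begin

definition permanent :: "'a :: comm_ring_1 mat \<Rightarrow> 'a" where
  "permanent A = (if dim_row A = dim_col A
     then (\<Sum>p \<in> {p. p permutes {0..<dim_row A}}. \<Prod>i = 0..<dim_row A. A $$ (i, p i))
     else 0)"

(* Matrix indices start at 0 here; since the entries depend only on j - i,
   this is the matrix with entries a_(j-i), 1 <= i, j <= n. *)
definition toeplitz_mat :: "nat \<Rightarrow> (int \<Rightarrow> 'a) \<Rightarrow> 'a mat" where
  "toeplitz_mat n a = mat n n (\<lambda>(i, j). a (int j - int i))"

definition toeplitz_perm :: "(int \<Rightarrow> 'a :: comm_ring_1) \<Rightarrow> nat \<Rightarrow> 'a" where
  "toeplitz_perm a n = permanent (toeplitz_mat n a)"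

lemma toeplitz_perm_0: "toeplitz_perm a 0 = 1"
  by (simp add: toeplitz_perm_def permanent_def toeplitz_mat_def)

(* The degree of the annihilator is degree q. The case q = 1 is allowed; it annihilates
   exactly the zero sequence. *)
definition annihilator :: "'a :: comm_ring_1 poly \<Rightarrow> (nat \<Rightarrow> 'a) \<Rightarrow> bool" where
  "annihilator q u \<longleftrightarrow>
     lead_coeff q = 1 \<and> (\<forall>k. (\<Sum>i\<le>degree q. coeff q i * u (k + i)) = 0)"

end

theory Submission
  imports Defs "Jordan_Normal_Form.Determinant"
begin

text \<open>
  Expand the permanent along the rows of the infinite Toeplitz matrix, starting with all columns
  of negative index used.  Because of the band structure, after \<open>n\<close> rows the set of used columns
  contains \<open>{..<n - m}\<close> and lies in \<open>{..<n + m}\<close>, so it is described by an \<open>m\<close>-subset of a window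
  of length \<open>2m\<close>, and the weights of these \<open>N = (2m choose m)\<close> states evolve linearly.  Linear
  dependence of the first \<open>N + 1\<close> weight vectors yields a recurrence of order exactly \<open>N\<close> for
  \<open>P\<^sub>n\<close>.  As \<open>P\<^sub>n\<close> vanishes for odd \<open>n\<close> and \<open>N\<close> is even, the terms of even index already
  form a recurrence, which has order \<open>N / 2\<close> on the even subsequence.
\<close>

section \<open>Linear dependence of N + 1 vectors with N coordinates\<close>

text \<open>A kernel vector of the matrix with columns \<open>f 0\<close>, ..., \<open>f N\<close>
  is a nontrivial relation; cutting it off at its last nonzero coordinate and dividing by that
  coordinate makes it monic.\<close>

lemma monic_linear_dependence:
  fixes f :: "nat \<Rightarrow> 's \<Rightarrow> 'a :: field"
  assumes X: "finite X"
  shows "\<exists>d c. d \<le> card X \<and> c d = 1 \<and> (\<forall>s\<in>X. (\<Sum>i\<le>d. c i * f i s) = 0)"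
proof -
  define N where "N = card X"
  obtain h where h: "bij_betw h {0..<N} X"
    using ex_bij_betw_nat_finite[OF X] unfolding N_def by blast
  \<comment> \<open>The zero row pads the matrix to a square one and makes it singular, so that the
    determinant criterion yields a kernel vector.\<close>
  define A where "A = mat (Suc N) (Suc N) (\<lambda>(i, j). if i < N then f j (h i) else 0)"
  have A: "A \<in> carrier_mat (Suc N) (Suc N)" by (simp add: A_def)
  have "transpose_mat A *\<^sub>v unit_vec (Suc N) N = 0\<^sub>v (Suc N)"
    by (rule eq_vecI) (auto simp: A_def)
  then have "det (transpose_mat A) = 0"
    using det_0_iff_vec_prod_zero_field[of "transpose_mat A" "Suc N"] A
    by (metis transpose_carrier_mat unit_vec_carrier unit_vec_nonzero lessI)
  then have "det A = 0" using det_transpose[OF A] by simp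
  then obtain v where v: "v \<in> carrier_vec (Suc N)" "v \<noteq> 0\<^sub>v (Suc N)" "A *\<^sub>v v = 0\<^sub>v (Suc N)"
    using det_0_iff_vec_prod_zero_field[OF A] by blast
  have rel: "(\<Sum>j\<le>N. v $ j * f j s) = 0" if s: "s \<in> X" for s
  proof -
    obtain i where i: "i < N" "s = h i" using h s unfolding bij_betw_def by auto
    have "0 = (A *\<^sub>v v) $ i" using v i by simp
    also have "\<dots> = (\<Sum>j<Suc N. f j s * v $ j)"
      using i v(1) by (simp add: A_def scalar_prod_def atLeast0LessThan)
    finally show ?thesis by (simp add: lessThan_Suc_atMost mult.commute)
  qed
  define I where "I = {j. j \<le> N \<and> v $ j \<noteq> 0}"
  define d where "d = Max I"
  have "I \<noteq> {}"
  proof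
    assume "I = {}"
    then have "v = 0\<^sub>v (Suc N)" using v(1) by (intro eq_vecI) (auto simp: I_def)
    then show False using v(2) by simp
  qed
  moreover have fin: "finite I" by (simp add: I_def)
  ultimately have "d \<in> I" unfolding d_def by (rule Max_in[rotated])
  then have d: "d \<le> N" "v $ d \<noteq> 0" by (auto simp: I_def)
  have beyond: "v $ j = 0" if "d < j" "j \<le> N" for j
    using that Max_ge[OF fin, of j] unfolding d_def[symmetric] by (fastforce simp: I_def)
  have "(\<Sum>i\<le>d. (v $ i / v $ d) * f i s) = 0" if "s \<in> X" for s
  proof -
    have "(\<Sum>i\<le>d. v $ i * f i s) = (\<Sum>i\<le>N. v $ i * f i s)"
      using d beyond by (intro sum.mono_neutral_left) auto
    then show ?thesis
      using rel[OF that] by (simp add: sum_divide_distrib[symmetric])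
  qed
  then show ?thesis
    using d unfolding N_def by (intro exI[of _ d] exI[of _ "\<lambda>i. v $ i / v $ d"]) auto
qed

section \<open>Expansion of permanents along rows\<close>

text \<open>Rows \<open>0..<n\<close> of the infinite Toeplitz matrix against the columns
  \<open>g 0\<close>, ..., \<open>g (n - 1)\<close>. Arbitrary columns are allowed because expansion
  along a row leaves gaps.\<close>

definition labelled_permanent :: "(int \<Rightarrow> 'a :: comm_ring_1) \<Rightarrow> nat \<Rightarrow> (nat \<Rightarrow> int) \<Rightarrow> 'a" where
  "labelled_permanent a n g = (\<Sum>p | p permutes {..<n}. \<Prod>i<n. a (g (p i) - int i))"

lemma toeplitz_perm_eq_labelled: "toeplitz_perm a n = labelled_permanent a n int"
  by (auto simp: toeplitz_perm_def permanent_def toeplitz_mat_def labelled_permanent_def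
      atLeast0LessThan intro!: sum.cong prod.cong dest: permutes_in_image)

text \<open>Expansion along the last row: it takes column \<open>g b\<close>, and the transposition
  moves \<open>g n\<close> into the vacated slot \<open>b\<close>, so the remaining columns are
  again indexed by \<open>{..<n}\<close>.\<close>

lemma labelled_permanent_Suc:
  "labelled_permanent a (Suc n) g =
    (\<Sum>b\<le>n. a (g b - int n) * labelled_permanent a n (g \<circ> transpose n b))"
proof -
  have "labelled_permanent a (Suc n) g =
    (\<Sum>b\<in>insert n {..<n}. \<Sum>q | q permutes {..<n}.
      \<Prod>i<Suc n. a (g ((transpose n b \<circ> q) i) - int i))"
    unfolding labelled_permanent_def lessThan_Suc[of n]
    by (rule sum_over_permutations_insert) auto
  also have "\<dots> = (\<Sum>b\<le>n. \<Sum>q | q permutes {..<n}. a (g b - int n) *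
      (\<Prod>i<n. a ((g \<circ> transpose n b) (q i) - int i)))"
    by (intro sum.cong) (auto simp: permutes_not_in mult.commute)
  finally show ?thesis by (simp add: labelled_permanent_def sum_distrib_left)
qed

text \<open>The weighted number of ways in which the first \<open>n\<close> rows can use exactly the columns of
  \<open>S\<close> that are not negative.\<close>

fun row_expansion :: "(int \<Rightarrow> 'a :: comm_ring_1) \<Rightarrow> nat \<Rightarrow> nat \<Rightarrow> int set \<Rightarrow> 'a" where
  "row_expansion a m 0 S = of_bool (S = {..<0})"
| "row_expansion a m (Suc n) S =
    (\<Sum>c\<in>S \<inter> {int n - int m..int n + int m}. a (c - int n) * row_expansion a m n (S - {c}))"

text \<open>The recursion only removes columns from \<open>S\<close>, so it can never end in
  \<open>{..<0}\<close>.\<close>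

lemma row_expansion_eq_0_low: "x < 0 \<Longrightarrow> x \<notin> S \<Longrightarrow> row_expansion a m n S = 0"
  by (induction n arbitrary: S) auto

text \<open>The rows before \<open>n\<close> reach no column beyond
  \<open>n - 1 + m\<close>.\<close>

lemma row_expansion_eq_0_high:
  "int n + int m \<le> x \<Longrightarrow> x \<in> S \<Longrightarrow> row_expansion a m n S = 0"
proof (induction n arbitrary: S)
  case (Suc n)
  have "row_expansion a m n (S - {c}) = 0" if "c \<le> int n + int m" for c
    using Suc.prems that by (intro Suc.IH) auto
  then show ?case by simp
qed auto

text \<open>Both sides obey the same last-row expansion. The index sets differ only in negative
  columns, whose removal leaves weight 0, and in columns outside the band, where \<open>a\<close>
  vanishes.\<close>

lemma row_expansion_labelled:
  assumes band: "\<And>s. \<bar>s\<bar> > int m \<Longrightarrow> a s = 0"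
  shows "inj_on g {..<n} \<Longrightarrow> (\<forall>i<n. 0 \<le> g i) \<Longrightarrow>
    row_expansion a m n ({..<0} \<union> g ` {..<n}) = labelled_permanent a n g"
proof (induction n arbitrary: g)
  case 0
  then show ?case by (simp add: labelled_permanent_def)
next
  case (Suc n)
  let ?S = "{..<0} \<union> g ` {..<Suc n}"
  let ?w = "\<lambda>c. a (c - int n) * row_expansion a m n (?S - {c})"
  have "row_expansion a m (Suc n) ?S = (\<Sum>c\<in>?S \<inter> {int n - int m..int n + int m}. ?w c)"
    by simp
  also have "\<dots> = (\<Sum>c\<in>g ` {..<Suc n} \<inter> {int n - int m..int n + int m}. ?w c)"
  proof (intro sum.mono_neutral_right ballI)
    fix c
    assume "c \<in> ?S \<inter> {int n - int m..int n + int m} - g ` {..<Suc n} \<inter> {int n - int m..int n + int m}"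
    then have "c < 0" by auto
    then show "?w c = 0" by (subst row_expansion_eq_0_low[of c]) auto
  qed auto
  also have "\<dots> = (\<Sum>c\<in>g ` {..<Suc n}. ?w c)"
  proof (intro sum.mono_neutral_left ballI)
    fix c
    assume "c \<in> g ` {..<Suc n} - g ` {..<Suc n} \<inter> {int n - int m..int n + int m}"
    then have "\<bar>c - int n\<bar> > int m" by auto
    then show "?w c = 0" by (simp add: band)
  qed auto
  also have "\<dots> = (\<Sum>b<Suc n. ?w (g b))"
    using Suc.prems(1) by (simp add: sum.reindex)
  also have "\<dots> = (\<Sum>b<Suc n. a (g b - int n) * labelled_permanent a n (g \<circ> transpose n b))"
  proof (intro sum.cong refl)
    fix b assume b: "b \<in> {..<Suc n}"
    have t: "transpose n b permutes {..<Suc n}"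
      using b by (intro permutes_swap_id) auto
    have image: "transpose n b ` {..<n} = {..<Suc n} - {b}"
    proof -
      have "transpose n b ` ({..<Suc n} - {n}) = {..<Suc n} - {b}"
        by (simp add: image_set_diff[OF permutes_inj[OF t]] permutes_image[OF t])
      then show ?thesis by (simp add: lessThan_Suc)
    qed
    have "inj_on (g \<circ> transpose n b) {..<n}"
      using Suc.prems(1) permutes_inj_on[OF t]
      by (intro comp_inj_on) (auto simp: image intro: inj_on_subset)
    moreover have "\<forall>i<n. 0 \<le> (g \<circ> transpose n b) i"
      using Suc.prems(2) permutes_in_image[OF t] by auto
    ultimately have "row_expansion a m n ({..<0} \<union> (g \<circ> transpose n b) ` {..<n}) =
        labelled_permanent a n (g \<circ> transpose n b)"
      by (rule Suc.IH)
    moreover have "?S - {g b} = {..<0} \<union> (g \<circ> transpose n b) ` {..<n}"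
    proof -
      have "g ` ({..<Suc n} - {b}) = g ` {..<Suc n} - {g b}"
        using b Suc.prems(1) by (subst inj_on_image_set_diff[of _ "{..<Suc n}"]) auto
      moreover have "0 \<le> g b" using b Suc.prems(2) by auto
      ultimately show ?thesis unfolding image_comp[symmetric] image by auto
    qed
    ultimately show "?w (g b) = a (g b - int n) * labelled_permanent a n (g \<circ> transpose n b)"
      by simp
  qed
  finally show ?case by (simp only: labelled_permanent_Suc lessThan_Suc_atMost)
qed

section \<open>Window states and their linear evolution\<close>

text \<open>Positions in \<open>A\<close> are relative to the diagonal, which makes the transition
  rule independent of \<open>n\<close>.\<close>

definition window_state :: "nat \<Rightarrow> nat \<Rightarrow> int set \<Rightarrow> int set" where
  "window_state m n A = {..<int n - int m} \<union> (\<lambda>x. x + int n) ` A"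

lemma toeplitz_perm_eq_row_expansion:
  assumes band: "\<And>s. \<bar>s\<bar> > int m \<Longrightarrow> a s = 0"
  shows "toeplitz_perm a n = row_expansion a m n (window_state m n {- int m..<0})"
proof -
  have "int ` {..<n} = {0..<int n}"
    by (simp add: image_int_atLeastLessThan flip: atLeast0LessThan)
  then have "window_state m n {- int m..<0} = {..<0} \<union> int ` {..<n}"
    unfolding window_state_def image_add_atLeastLessThan' by auto
  then show ?thesis
    using row_expansion_labelled[of m a int n] band by (simp add: toeplitz_perm_eq_labelled)
qed

text \<open>\<open>V\<close> is \<open>A\<close> seen from row \<open>n\<close>: positions rise by
  1, and the lowest window column, until then in the part that is always used, appears as
  \<open>- m\<close>. Neither \<open>V\<close> nor the coefficients depend on
  \<open>n\<close>.\<close>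

lemma row_expansion_window_Suc:
  fixes A :: "int set"
  assumes A: "A \<subseteq> {- int m..<int m}"
  defines "V \<equiv> insert (- int m) ((\<lambda>x. x + 1) ` A)"
  shows "row_expansion a m (Suc n) (window_state m (Suc n) A) =
    (\<Sum>c\<in>V. a c * row_expansion a m n (window_state m n (V - {c})))"
proof -
  let ?S = "window_state m (Suc n) A"
  let ?t = "\<lambda>x. x + int n"
  have S: "?S = {..<int n - int m} \<union> ?t ` V"
    by (auto simp: window_state_def V_def image_image algebra_simps)
  have V: "V \<subseteq> {- int m..int m}" using A by (auto simp: V_def)
  have "?S \<inter> {int n - int m..int n + int m} = ?t ` V"
    using V unfolding S by auto
  then have "row_expansion a m (Suc n) ?S =
      (\<Sum>c\<in>V. a c * row_expansion a m n (?S - {?t c}))"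
    by (simp add: sum.reindex)
  also have "\<dots> = (\<Sum>c\<in>V. a c * row_expansion a m n (window_state m n (V - {c})))"
  proof (intro sum.cong refl)
    fix c assume "c \<in> V"
    then have "?S - {?t c} = window_state m n (V - {c})"
      using V unfolding S by (auto simp: window_state_def)
    then show "a c * row_expansion a m n (?S - {?t c}) =
      a c * row_expansion a m n (window_state m n (V - {c}))" by simp
  qed
  finally show ?thesis .
qed

text \<open>After \<open>n\<close> rows, \<open>n\<close> columns have been added to
  \<open>{..<0}\<close>; compared with \<open>{..<n - m}\<close> this is an excess of
  \<open>m\<close>, whence the cardinality.\<close>

definition states :: "nat \<Rightarrow> int set set" where
  "states m = {A. A \<subseteq> {- int m..<int m} \<and> card A = m}"

lemma finite_states: "finite (states m)"
  by (rule finite_subset[of _ "Pow {- int m..<int m}"]) (auto simp: states_def)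

lemma card_states: "card (states m) = (2 * m) choose m"
proof -
  have "card {- int m..<int m} = 2 * m" by simp
  then show ?thesis
    unfolding states_def by (subst n_subsets) (rule finite_atLeastLessThan_int, rule arg_cong)
qed

text \<open>The weight vectors are iterates of one fixed linear map, and applying that map preserves
  a linear relation among them.\<close>

lemma row_expansion_recurrence:
  fixes a :: "int \<Rightarrow> 'a :: comm_ring_1"
  assumes base: "\<And>A. A \<in> states m \<Longrightarrow>
    (\<Sum>i\<le>d. c i * row_expansion a m i (window_state m i A)) = 0"
  shows "A \<in> states m \<Longrightarrow>
    (\<Sum>i\<le>d. c i * row_expansion a m (k + i) (window_state m (k + i) A)) = 0"
proof (induction k arbitrary: A)
  case 0
  then show ?case using base by simp
next
  case (Suc k)
  define V where "V = insert (- int m) ((\<lambda>x. x + 1) ` A)"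
  have A: "A \<subseteq> {- int m..<int m}" "card A = m" using Suc.prems by (auto simp: states_def)
  then have fin: "finite A" using finite_subset by blast
  have V: "V \<subseteq> {- int m..int m}" using A by (auto simp: V_def)
  have cardV: "card V = Suc m"
    unfolding V_def using A fin by (subst card_insert_disjoint) (auto simp: card_image)
  \<comment> \<open>A set \<open>V - {x}\<close> containing \<open>m\<close> is not a state, but its
    weight is 0 because the first \<open>n\<close> rows cannot reach column
    \<open>n + m\<close>.\<close>
  have vanish: "(\<Sum>i\<le>d. c i * row_expansion a m (k + i) (window_state m (k + i) (V - {x}))) = 0"
    if x: "x \<in> V" for x
  proof (cases "int m \<in> V - {x}")
    case True
    have "row_expansion a m n (window_state m n (V - {x})) = 0" for n
      by (rule row_expansion_eq_0_high[of n m "int m + int n"])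
        (use True in \<open>auto simp: window_state_def\<close>)
    then show ?thesis by simp
  next
    case False
    have "V - {x} \<subseteq> {- int m..<int m}"
    proof
      fix y assume y: "y \<in> V - {x}"
      then have "y \<noteq> int m" using False by auto
      then show "y \<in> {- int m..<int m}" using y V by fastforce
    qed
    then have "V - {x} \<in> states m"
      using x cardV by (simp add: states_def card_Diff_singleton)
    then show ?thesis by (rule Suc.IH)
  qed
  have "(\<Sum>i\<le>d. c i * row_expansion a m (Suc k + i) (window_state m (Suc k + i) A)) =
    (\<Sum>i\<le>d. c i * (\<Sum>x\<in>V. a x *
      row_expansion a m (k + i) (window_state m (k + i) (V - {x}))))"
    using row_expansion_window_Suc[OF A(1), of a] by (simp add: V_def del: row_expansion.simps)
  also have "\<dots> = (\<Sum>x\<in>V. a x *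
      (\<Sum>i\<le>d. c i * row_expansion a m (k + i) (window_state m (k + i) (V - {x}))))"
    unfolding sum_distrib_left by (subst sum.swap) (simp add: mult.left_commute)
  also have "\<dots> = 0" by (simp add: vanish)
  finally show ?case .
qed

text \<open>The permanents form the coordinate of the weight vectors at the state
  \<open>{- m..<0}\<close>. The order is fixed as exactly \<open>N\<close>, since the passage to
  even indices needs an even order.\<close>

theorem toeplitz_perm_recurrence:
  fixes a :: "int \<Rightarrow> 'a :: field"
  assumes band: "\<And>s. \<bar>s\<bar> > int m \<Longrightarrow> a s = 0"
  defines "N \<equiv> (2 * m) choose m"
  shows "\<exists>c. c N = 1 \<and> (\<forall>k. (\<Sum>i\<le>N. c i * toeplitz_perm a (k + i)) = 0)"
proof -
  obtain d c where d: "d \<le> N" "c d = 1"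
    and dep: "\<forall>A\<in>states m. (\<Sum>i\<le>d. c i * row_expansion a m i (window_state m i A)) = 0"
    using monic_linear_dependence[OF finite_states,
        of m "\<lambda>i A. row_expansion a m i (window_state m i A)"]
    unfolding card_states N_def by blast
  have init: "{- int m..<0} \<in> states m" by (auto simp: states_def)
  have expansion: "toeplitz_perm a n = row_expansion a m n (window_state m n {- int m..<0})" for n
    by (rule toeplitz_perm_eq_row_expansion) (rule band)
  have rec: "(\<Sum>i\<le>d. c i * toeplitz_perm a (k + i)) = 0" for k
    unfolding expansion by (rule row_expansion_recurrence[OF bspec[OF dep] init])
  \<comment> \<open>Multiplying the characteristic polynomial by t^(N - d) raises the order from
    \<open>d\<close> to \<open>N\<close> and keeps it monic.\<close>
  define e where "e i = (if i < N - d then 0 else c (i - (N - d)))" for i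
  have "(\<Sum>i\<le>N. e i * toeplitz_perm a (k + i)) = 0" for k
  proof -
    have "(\<Sum>i\<le>N. e i * toeplitz_perm a (k + i)) =
        (\<Sum>i\<in>{N - d..N}. e i * toeplitz_perm a (k + i))"
      by (intro sum.mono_neutral_right) (auto simp: e_def)
    also have "\<dots> = (\<Sum>i\<le>d. c i * toeplitz_perm a ((k + (N - d)) + i))"
      using d(1) by (intro sum.reindex_bij_witness[of _ "\<lambda>i. i + (N - d)" "\<lambda>i. i - (N - d)"])
        (auto simp: e_def)
    finally show ?thesis using rec by simp
  qed
  moreover have "e N = 1" using d by (simp add: e_def)
  ultimately show ?thesis by blast
qed

section \<open>Vanishing at odd sizes\<close>

lemma toeplitz_perm_uminus:
  "toeplitz_perm (\<lambda>s. - a s) n = (- 1) ^ n * toeplitz_perm a n"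
  unfolding toeplitz_perm_eq_labelled labelled_permanent_def
  by (simp add: prod_uminus sum_distrib_left)

text \<open>This is invariance of the permanent under transposition, obtained by summing over
  inverse permutations.\<close>

lemma toeplitz_perm_reflect: "toeplitz_perm (\<lambda>s. a (- s)) n = toeplitz_perm a n"
proof -
  have "(\<Prod>i<n. a (- (int (inv_into UNIV p i) - int i))) = (\<Prod>i<n. a (int (p i) - int i))"
    if p: "p permutes {..<n}" for p
    using prod.permute[OF p, of "\<lambda>i. a (- (int (inv_into UNIV p i) - int i))"]
    by (simp add: comp_def permutes_inverses[OF p])
  then show ?thesis
    unfolding toeplitz_perm_eq_labelled labelled_permanent_def
    by (subst sum_permutations_inverse) (rule sum.cong, auto)
qed

text \<open>Transposing a skew-symmetric matrix negates each of its \<open>n\<close> rows, so the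
  permanent equals its own negative for odd \<open>n\<close>.\<close>

lemma toeplitz_perm_skew_odd:
  fixes a :: "int \<Rightarrow> 'a :: field"
  assumes char: "CHAR('a) \<noteq> 2" and skew: "\<And>s. a (- s) = - a s" and n: "odd n"
  shows "toeplitz_perm a n = 0"
proof -
  have two: "(2 :: 'a) \<noteq> 0"
  proof
    assume "(2 :: 'a) = 0"
    then have "CHAR('a) dvd 2" using of_nat_eq_0_iff_char_dvd[of 2, where 'a = 'a] by simp
    then have "CHAR('a) = 1 \<or> CHAR('a) = 2" using two_is_prime_nat prime_nat_iff by blast
    then show False using char by simp
  qed
  have "toeplitz_perm a n = - toeplitz_perm a n"
    using toeplitz_perm_reflect[of a n] toeplitz_perm_uminus[of a n] n by (simp add: skew)
  then have "2 * toeplitz_perm a n = 0" unfolding mult_2 by (rule eq_neg_iff_add_eq_0[THEN iffD1])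
  then show ?thesis using two by simp
qed

section \<open>The even subsequence and the degree bound\<close>

text \<open>At an even shift \<open>2 * k\<close> the terms with odd \<open>i\<close> vanish, so the
  coefficients \<open>c (2 * j)\<close> alone give a relation; it stays monic because the order
  \<open>2 * M\<close> is even.\<close>

lemma annihilator_even_subsequence:
  fixes u :: "nat \<Rightarrow> 'a :: comm_ring_1"
  assumes odd: "\<And>n. odd n \<Longrightarrow> u n = 0"
    and c: "c (2 * M) = 1" "\<And>k. (\<Sum>i\<le>2 * M. c i * u (k + i)) = 0"
  shows "\<exists>q. annihilator q (\<lambda>k. u (2 * k)) \<and> degree q = M"
proof -
  define q where "q = (\<Sum>j\<le>M. monom (c (2 * j)) j)"
  have coeff: "coeff q j = (if j \<le> M then c (2 * j) else 0)" for j
    by (simp add: q_def coeff_sum)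
  have deg: "degree q = M"
    by (rule antisym) (auto intro: degree_le le_degree simp: coeff c(1))
  have "(\<Sum>i\<le>M. coeff q i * u (2 * (k + i))) = 0" for k
  proof -
    have "(\<Sum>i\<le>2 * M. c i * u (2 * k + i)) = (\<Sum>i | i \<le> 2 * M \<and> even i. c i * u (2 * k + i))"
      by (intro sum.mono_neutral_right) (auto simp: odd)
    also have "\<dots> = (\<Sum>i\<le>M. coeff q i * u (2 * (k + i)))"
      by (rule sum.reindex_bij_witness[of _ "\<lambda>i. 2 * i" "\<lambda>i. i div 2"])
        (auto simp: coeff algebra_simps)
    finally show ?thesis using c(2) by simp
  qed
  then show ?thesis
    unfolding annihilator_def using deg coeff c(1) by (intro exI[of _ q]) auto
qed

theorem proposition5p4:
  fixes a :: "int \<Rightarrow> 'a :: field" and m :: nat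
  assumes char: "CHAR('a) \<noteq> 2"
    and m: "m \<ge> 1"
    and zero: "a 0 = 0"
    and skew: "\<And>s. 1 \<le> s \<Longrightarrow> s \<le> int m \<Longrightarrow> a (- s) = - a s"
    and band: "\<And>s. \<bar>s\<bar> > int m \<Longrightarrow> a s = 0"
  shows "(\<forall>k. toeplitz_perm a (2 * k + 1) = 0) \<and>
    (\<exists>q. annihilator q (\<lambda>k. toeplitz_perm a (2 * k)) \<and>
         real (degree q) \<le> 1 / 2 * real ((2 * m) choose m))"
proof -
  have "a (- s) = - a s" for s
  proof -
    consider "\<bar>s\<bar> > int m" | "s = 0" | "1 \<le> s" "s \<le> int m" | "1 \<le> - s" "- s \<le> int m"
      by linarith
    then show ?thesis
      by cases (use zero skew[of s] skew[of "- s"] band[of s] band[of "- s"] in auto)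
  qed
  then have odd: "toeplitz_perm a n = 0" if "odd n" for n
    using toeplitz_perm_skew_odd[OF char _ that] by blast
  \<comment> \<open>Pascal's rule splits the central binomial coefficient into two equal ones; this
    needs \<open>m\<close> positive.\<close>
  have "even ((2 * m) choose m)"
  proof -
    obtain l where l: "m = Suc l" using m by (cases m) auto
    have "(2 * m) choose m = (Suc (2 * l) choose l) + (Suc (2 * l) choose Suc l)"
      by (simp add: l)
    moreover have "Suc (2 * l) choose l = Suc (2 * l) choose Suc l"
      by (subst binomial_symmetric) auto
    ultimately show ?thesis by simp
  qed
  then obtain M where M: "(2 * m) choose m = 2 * M" by (elim evenE)
  obtain c where "c (2 * M) = 1" "\<And>k. (\<Sum>i\<le>2 * M. c i * toeplitz_perm a (k + i)) = 0"
    using toeplitz_perm_recurrence[of m a] band unfolding M by blast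
  from annihilator_even_subsequence[of "toeplitz_perm a", OF odd this]
  show ?thesis using odd by (auto simp: M)
qed

end
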